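(* Given a polynomial equation of degree three $x^3+px+q=0$ ($p,q\neq 0$) with real coefficients, we can rewrite it as $x^3-3rsx+rs(r+s)=0$ (that is, with $p=-3rs$ and $q=rs(r+s)$). Then the three solutions to this equation are $$-r^{1/3}s^{1/3}\left(r^{1/3}+s^{1/3}\right),\quad -r^{1/3}s^{1/3}\left(\omega r^{1/3}+\omega^2 s^{1/3}\right),\quad -r^{1/3}s^{1/3}\left(\omega^2 r^{1/3}+\omega s^{1/3}\right).$$ In particular, when $r=s$ the three solutions can be further simplified as $$-2\sqrt{rs},\quad \sqrt{rs},\quad \sqrt{rs}.$$ When $r\neq s$, and $r$ and $s$ are complex conjugates, we can let $\theta=\mathrm{Arg}(r)$. Then the three solutions can be further simplified as $$-2\sqrt{rs}\cos\frac{\theta}{3},\quad -2\sqrt{rs}\cos\left(\frac{\theta}{3}+\frac{2\pi}{3}\right),\quad -2\sqrt{rs}\cos\left(\frac{\theta}{3}+\frac{4\pi}{3}\right).$$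
   Context: $\omega=e^{2\pi i/3}=\frac{-1+\sqrt{3}i}{2}$. The numbers $r,s$ are the two (real or complex conjugate) numbers determined by $p=-3rs$ and $q=rs(r+s)$. For a nonzero complex number $z$, $\mathrm{Arg}(z)\in(-\pi,\pi]$ is its argument, so $z=|z|e^{i\,\mathrm{Arg}(z)}$. Cube roots: if $z$ is real, $z^{1/3}$ denotes the real cube root of $z$; if $z$ is not real, $z^{1/3}=\sqrt[3]{|z|}\,e^{i\,\mathrm{Arg}(z)/3}$. For a positive real number $x$, $\sqrt{x}$ denotes its positive square root.
   Formalization: When r = s, the printed solutions −2√(rs), √(rs), √(rs) hold only for r = s > 0; for r = s < 0 the formal statement gives 2√(rs), −√(rs), −√(rs) instead (e.g. r = s = −1: x³−3x−2 has roots 2, −1, −1). *)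

theory Defs
  imports
    "HOL-Analysis.Analysis"
    "HOL-Computational_Algebra.Computational_Algebra"
begin

text \<open>
  On the reals this is the real cube root, which for negative arguments differs from the
  principal branch (the formula of the second case).
\<close>

definition cube_root :: "complex \<Rightarrow> complex" where
  "cube_root z =
     (if z \<in> \<real> then complex_of_real (root 3 (Re z))
      else complex_of_real (root 3 (norm z)) * exp (\<i> * complex_of_real (Arg z / 3)))"

definition omega :: complex where
  "omega = exp (2 * complex_of_real pi * \<i> / 3)"

end

theory Submission
  imports Defs
begin

text \<open>
  If a^3 = r and b^3 = s, the elementary symmetric functions of the three stated numbers are
  0, -3rs and -rs(r + s), because 1 + \<omega> + \<omega>^2 = 0. In the conjugate case
  the two cube roots are conjugate as well, so each solution is a multiple of z + cnj z = 2 Re z.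
\<close>

lemma omega_cis: "omega = cis (2 * pi / 3)"
  by (simp add: omega_def cis_conv_exp algebra_simps)

text \<open>This is the relation 1 + \<open>omega\<close> + \<open>omega\<close>^2 = 0, solved for
  the square so that it can serve as a rewrite rule lowering powers of \<open>omega\<close>.\<close>

lemma omega_squared: "omega\<^sup>2 = - 1 - omega"
proof -
  have "omega = Complex (- 1 / 2) (sqrt 3 / 2)"
    by (simp add: omega_cis complex_eq_iff cos_120 sin_120)
  show ?thesis
    unfolding \<open>omega = _\<close> by (simp add: complex_eq_iff power2_eq_square)
qed

text \<open>On the reals this works for either sign because 3 is odd; elsewhere De Moivre triples
  the angle \<open>Arg z / 3\<close> and gives back the polar form of \<open>z\<close>.\<close>

lemma cube_root_cubed: "cube_root z ^ 3 = z"
proof (cases "z \<in> \<real>")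
  case True
  then show ?thesis
    by (simp add: cube_root_def odd_real_root_pow flip: of_real_power)
next
  case False
  have "exp (\<i> * of_real (Arg z / 3)) ^ 3 = cis (Arg z)"
    unfolding cis_conv_exp[symmetric] Complex.DeMoivre by simp
  moreover have "complex_of_real (root 3 (norm z)) ^ 3 = of_real (norm z)"
    by (simp flip: of_real_power)
  ultimately show ?thesis
    using False rcis_cmod_Arg[of z] by (simp add: cube_root_def power_mult_distrib rcis_def)
qed

lemma cube_root_nonreal:
  assumes "z \<notin> \<real>"
  shows "cube_root z = rcis (root 3 (norm z)) (Arg z / 3)"
  using assms by (simp add: cube_root_def rcis_def cis_conv_exp)

text \<open>Off the real axis the argument is never \<pi>, so conjugation negates it and hence also
  its third, while the modulus stays the same.\<close>

lemma cube_root_cnj_nonreal: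
  assumes "z \<notin> \<real>"
  shows "cube_root (cnj z) = cnj (cube_root z)"
proof -
  have "cnj z \<notin> \<real>"
    using assms by (simp add: complex_is_Real_iff)
  moreover have "Arg (cnj z) = - Arg z"
    using assms by (simp add: Arg_cnj)
  ultimately show ?thesis
    using assms by (simp add: cube_root_nonreal rcis_def cis_cnj)
qed

text \<open>Stating the cubic through the cube roots \<open>a\<close> and \<open>b\<close> turns
  Vieta's relations into polynomial identities modulo \<open>omega\<close>^2 + \<open>omega\<close>
  + 1. Equality with a multiset of roots also records multiplicities.\<close>

lemma proots_depressed_cubic:
  fixes a b :: complex
  shows "proots [:a ^ 3 * b ^ 3 * (a ^ 3 + b ^ 3), - 3 * a ^ 3 * b ^ 3, 0, 1:] =
    {# - (a * b * (a + b)), - (a * b * (omega * a + omega\<^sup>2 * b)),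
       - (a * b * (omega\<^sup>2 * a + omega * b)) #}"
proof -
  let ?x1 = "- (a * b * (a + b))"
  let ?x2 = "- (a * b * (omega * a + omega\<^sup>2 * b))"
  let ?x3 = "- (a * b * (omega\<^sup>2 * a + omega * b))"
  have w: "omega * omega = - 1 - omega"
    using omega_squared by (simp add: power2_eq_square)
  have "?x1 + ?x2 + ?x3 = 0"
    using w unfolding power2_eq_square by algebra
  moreover have "?x1 * ?x2 + ?x1 * ?x3 + ?x2 * ?x3 = - 3 * a ^ 3 * b ^ 3"
    using w unfolding power2_eq_square by algebra
  moreover have "- (?x1 * ?x2 * ?x3) = a ^ 3 * b ^ 3 * (a ^ 3 + b ^ 3)"
    using w unfolding power2_eq_square by algebra
  \<comment> \<open>Vieta's formulas: the three symmetric functions just computed are, up to sign,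
    the coefficients of the product of the linear factors.\<close>
  moreover have expand: "[:- x, 1:] * ([:- y, 1:] * [:- z, 1:]) =
      [:- (x * y * z), x * y + x * z + y * z, - (x + y + z), 1:]" for x y z :: complex
    by (simp add: algebra_simps)
  ultimately have "[:a ^ 3 * b ^ 3 * (a ^ 3 + b ^ 3), - 3 * a ^ 3 * b ^ 3, 0, 1:] =
      [:- ?x1, 1:] * ([:- ?x2, 1:] * [:- ?x3, 1:])"
    unfolding expand by (simp only: minus_zero)
  also have "proots \<dots> = {# ?x1, ?x2, ?x3 #}"
    by (subst proots_mult, simp, simp, subst proots_mult, simp, simp) simp
  finally show ?thesis .
qed

text \<open>The witnesses are the two roots of t^2 - St + P given by the quadratic formula.\<close>

lemma exists_sum_prod:
  fixes S P :: complex
  obtains r s where "r + s = S" "r * s = P"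
proof
  show "(S + csqrt (S\<^sup>2 - 4 * P)) / 2 + (S - csqrt (S\<^sup>2 - 4 * P)) / 2 = S"
    by (simp add: field_simps)
  have "(S + csqrt (S\<^sup>2 - 4 * P)) * (S - csqrt (S\<^sup>2 - 4 * P)) = 4 * P"
    by (simp add: square_diff_square_factored[symmetric] flip: power2_eq_square)
  then show "(S + csqrt (S\<^sup>2 - 4 * P)) / 2 * ((S - csqrt (S\<^sup>2 - 4 * P)) / 2) = P"
    by simp
qed

text \<open>Both numbers are roots of one real quadratic. Concretely, the real sum makes the
  imaginary parts opposite, and then \<open>Im (r * s)\<close> factors as
  \<open>Im r * (Re s - Re r)\<close>.\<close>

lemma real_or_cnj_if_sum_prod_real:
  assumes "r + s \<in> \<real>" "r * s \<in> \<real>"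
  shows "r \<in> \<real> \<and> s \<in> \<real> \<or> s = cnj r"
proof -
  have im: "Im s = - Im r"
    using assms(1) by (simp add: complex_is_Real_iff)
  have "Im r * (Re s - Re r) = 0"
    using assms(2) im by (simp add: complex_is_Real_iff algebra_simps)
  with im show ?thesis
    by (auto simp: complex_is_Real_iff complex_eq_iff)
qed

text \<open>The argument is the nonnegative real |z|^2, so the principal root is the ordinary one.
  This evaluates \<open>csqrt (r * s)\<close> both for conjugate \<open>r\<close>, \<open>s\<close>
  and for equal real ones.\<close>

lemma csqrt_mult_cnj: "csqrt (z * cnj z) = of_real (norm z)"
  by (simp add: of_real_sqrt flip: complex_norm_square of_real_power)

text \<open>Everything reduces to \<open>a\<close>^3 = \<open>r\<close> and \<open>omega\<close> +
  \<open>omega\<close>^2 = -1. The values are given through \<open>r\<close>, since the square root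
  of r^2 depends on the sign of \<open>r\<close>.\<close>

lemma solutions_equal:
  fixes r :: complex
  defines "a \<equiv> cube_root r"
  shows "- (a * a * (a + a)) = - 2 * r" "- (a * a * (omega * a + omega\<^sup>2 * a)) = r"
proof -
  have r: "a * a * a = r"
    using cube_root_cubed[of r] by (simp add: a_def power3_eq_cube)
  show "- (a * a * (a + a)) = - 2 * r"
    by (simp add: algebra_simps flip: r)
  show "- (a * a * (omega * a + omega\<^sup>2 * a)) = r"
    by (simp add: omega_squared algebra_simps flip: r)
qed

text \<open>With \<open>b\<close> = \<open>cnj a\<close>, the product \<open>a * b\<close> is m^2
  and the sum is twice the real part of \<open>w * a\<close>, where m^3 = |r|. Taking
  \<open>w\<close> to be 1, \<open>omega\<close> and \<open>omega\<close>^2 yields all three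
  roots.\<close>

lemma solution_cnj:
  fixes r :: complex
  assumes "r \<notin> \<real>" and "w = cis t"
  defines "a \<equiv> cube_root r" and "b \<equiv> cube_root (cnj r)"
  shows "- (a * b * (w * a + cnj w * b)) =
    - 2 * csqrt (r * cnj r) * of_real (cos (Arg r / 3 + t))"
proof -
  define m where "m = root 3 (norm r)"
  have a: "a = rcis m (Arg r / 3)"
    using assms by (simp add: a_def m_def cube_root_nonreal)
  have b: "b = cnj a"
    using assms by (simp add: a_def b_def cube_root_cnj_nonreal)
  have wa: "w * a = rcis m (Arg r / 3 + t)"
    by (simp add: a rcis_def \<open>w = cis t\<close> cis_mult algebra_simps)
  have "a * b = of_real (m\<^sup>2)"
    unfolding b by (simp add: a flip: complex_norm_square)
  moreover have "w * a + cnj w * b = of_real (2 * m * cos (Arg r / 3 + t))"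
    using complex_add_cnj[of "w * a"] unfolding b complex_cnj_mult[symmetric] by (simp add: wa)
  moreover have "m ^ 3 = norm r"
    by (simp add: m_def)
  ultimately have "- (a * b * (w * a + cnj w * b)) = of_real (- 2 * norm r * cos (Arg r / 3 + t))"
    by (simp add: power2_eq_square power3_eq_cube algebra_simps flip: of_real_mult)
  then show ?thesis
    unfolding csqrt_mult_cnj by simp
qed

theorem theorem3p1:
  fixes p q :: real
  assumes "p \<noteq> 0" and "q \<noteq> 0"
  shows "(\<exists>r s :: complex.
           complex_of_real p = - 3 * r * s \<and> complex_of_real q = r * s * (r + s)) \<and>
         (\<forall>r s :: complex.
           complex_of_real p = - 3 * r * s \<and> complex_of_real q = r * s * (r + s) \<longrightarrow>
           (r \<in> \<real> \<and> s \<in> \<real> \<or> s = cnj r) \<and>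
           (let a = cube_root r;
                b = cube_root s;
                x1 = - (a * b * (a + b));
                x2 = - (a * b * (omega * a + omega\<^sup>2 * b));
                x3 = - (a * b * (omega\<^sup>2 * a + omega * b))
            in proots [:complex_of_real q, complex_of_real p, 0, 1:] = {#x1, x2, x3#} \<and>
               (r = s \<and> Re r > 0 \<longrightarrow>
                  x1 = - 2 * csqrt (r * s) \<and> x2 = csqrt (r * s) \<and> x3 = csqrt (r * s)) \<and>
               (r = s \<and> Re r < 0 \<longrightarrow>
                  x1 = 2 * csqrt (r * s) \<and> x2 = - csqrt (r * s) \<and> x3 = - csqrt (r * s)) \<and>
               (r \<noteq> s \<and> s = cnj r \<longrightarrow>
                  (let \<theta> = Arg r
                   in x1 = - 2 * csqrt (r * s) * complex_of_real (cos (\<theta> / 3)) \<and>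
                      x2 = - 2 * csqrt (r * s) * complex_of_real (cos (\<theta> / 3 + 2 * pi / 3)) \<and>
                      x3 = - 2 * csqrt (r * s) * complex_of_real (cos (\<theta> / 3 + 4 * pi / 3))))))"
proof (intro conjI allI impI)
  have "complex_of_real p \<noteq> 0"
    using assms by simp
  \<comment> \<open>The two equations force these values: the first fixes the product, and dividing
    the second by it gives the sum.\<close>
  moreover obtain r s :: complex where "r + s = of_real (- 3 * q / p)" "r * s = of_real (- p / 3)"
    by (rule exists_sum_prod)
  ultimately have "complex_of_real p = - 3 * r * s \<and> complex_of_real q = r * s * (r + s)"
    by (simp add: mult.assoc)
  then show "\<exists>r s :: complex.
      complex_of_real p = - 3 * r * s \<and> complex_of_real q = r * s * (r + s)"
    by blast
next
  fix r s :: complex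
  assume pq: "complex_of_real p = - 3 * r * s \<and> complex_of_real q = r * s * (r + s)"
  have rs: "r * s = of_real (- p / 3)"
    using pq by simp
  have "- p / 3 \<noteq> 0"
    using assms by simp
  then have "r + s = of_real q / of_real (- p / 3)"
    using pq unfolding rs by (metis nonzero_mult_div_cancel_left of_real_eq_0_iff)
  then have "r + s \<in> \<real>"
    by (metis Reals_of_real of_real_divide)
  moreover have "r * s \<in> \<real>"
    unfolding rs by (rule Reals_of_real)
  ultimately show real_or_cnj: "r \<in> \<real> \<and> s \<in> \<real> \<or> s = cnj r"
    by (rule real_or_cnj_if_sum_prod_real)
  define a where "a = cube_root r"
  define b where "b = cube_root s"
  let ?x1 = "- (a * b * (a + b))"
  let ?x2 = "- (a * b * (omega * a + omega\<^sup>2 * b))"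
  let ?x3 = "- (a * b * (omega\<^sup>2 * a + omega * b))"
  have roots: "proots [:complex_of_real q, complex_of_real p, 0, 1:] = {#?x1, ?x2, ?x3#}"
    using proots_depressed_cubic[of a b] pq by (simp add: a_def b_def cube_root_cubed)
  \<comment> \<open>If \<open>r\<close> = \<open>s\<close>, either alternative of
    \<open>real_or_cnj\<close> makes \<open>r\<close> real. The absolute value is what later
    separates the two sign cases.\<close>
  have eq: "?x1 = - 2 * r \<and> ?x2 = r \<and> ?x3 = r \<and> csqrt (r * s) = of_real \<bar>Re r\<bar> \<and> r = of_real (Re r)"
    if "r = s"
  proof -
    have "cnj r = r"
      using real_or_cnj that by (auto simp: Reals_cnj_iff)
    then have "r \<in> \<real>"
      by (simp add: Reals_cnj_iff)
    then have "norm r = \<bar>Re r\<bar>" "r = of_real (Re r)"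
      by (simp_all add: in_Reals_norm)
    moreover have "csqrt (r * s) = of_real (norm r)"
      using csqrt_mult_cnj[of r] \<open>cnj r = r\<close> that by metis
    ultimately show ?thesis
      using solutions_equal[of r] that by (simp add: a_def b_def add.commute)
  qed
  have w2: "omega\<^sup>2 = cis (4 * pi / 3)"
    by (simp add: omega_cis Complex.DeMoivre)
  \<comment> \<open>Unit modulus and \<open>omega\<close>^3 = 1 show that conjugation swaps
    \<open>omega\<close> and its square, so the stated solutions take the form
    \<open>w * a + cnj w * b\<close>.\<close>
  have "cnj omega * omega = 1"
    by (simp add: omega_cis cis_cnj cis_mult)
  moreover have "omega ^ 3 = 1"
    by (simp add: omega_cis Complex.DeMoivre)
  ultimately have cnj_w: "cnj omega = omega\<^sup>2" "cnj (omega\<^sup>2) = omega"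
    by (metis (no_types, lifting) mult.assoc mult.commute mult_1 power2_eq_square power3_eq_cube complex_cnj_cnj)+
  have cc: "?x1 = - 2 * csqrt (r * s) * of_real (cos (Arg r / 3)) \<and>
      ?x2 = - 2 * csqrt (r * s) * of_real (cos (Arg r / 3 + 2 * pi / 3)) \<and>
      ?x3 = - 2 * csqrt (r * s) * of_real (cos (Arg r / 3 + 4 * pi / 3))"
    if "r \<noteq> s \<and> s = cnj r"
  proof -
    have "r \<notin> \<real>" "s = cnj r"
      using that by (auto simp: Reals_cnj_iff)
    then show ?thesis
      using solution_cnj[of r 1 0] solution_cnj[of r omega "2 * pi / 3"]
        solution_cnj[of r "omega\<^sup>2" "4 * pi / 3"] omega_cis w2
      unfolding a_def b_def cnj_w by simp
  qed
  show "let a = cube_root r;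
            b = cube_root s;
            x1 = - (a * b * (a + b));
            x2 = - (a * b * (omega * a + omega\<^sup>2 * b));
            x3 = - (a * b * (omega\<^sup>2 * a + omega * b))
        in proots [:complex_of_real q, complex_of_real p, 0, 1:] = {#x1, x2, x3#} \<and>
           (r = s \<and> Re r > 0 \<longrightarrow>
              x1 = - 2 * csqrt (r * s) \<and> x2 = csqrt (r * s) \<and> x3 = csqrt (r * s)) \<and>
           (r = s \<and> Re r < 0 \<longrightarrow>
              x1 = 2 * csqrt (r * s) \<and> x2 = - csqrt (r * s) \<and> x3 = - csqrt (r * s)) \<and>
           (r \<noteq> s \<and> s = cnj r \<longrightarrow>
              (let \<theta> = Arg r
               in x1 = - 2 * csqrt (r * s) * complex_of_real (cos (\<theta> / 3)) \<and>
                  x2 = - 2 * csqrt (r * s) * complex_of_real (cos (\<theta> / 3 + 2 * pi / 3)) \<and>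
                  x3 = - 2 * csqrt (r * s) * complex_of_real (cos (\<theta> / 3 + 4 * pi / 3))))"
    unfolding Let_def a_def[symmetric] b_def[symmetric]
  proof (rule conjI[OF roots], rule conjI[rotated], rule conjI[rotated])
    show "r \<noteq> s \<and> s = cnj r \<longrightarrow>
      ?x1 = - 2 * csqrt (r * s) * complex_of_real (cos (Arg r / 3)) \<and>
      ?x2 = - 2 * csqrt (r * s) * complex_of_real (cos (Arg r / 3 + 2 * pi / 3)) \<and>
      ?x3 = - 2 * csqrt (r * s) * complex_of_real (cos (Arg r / 3 + 4 * pi / 3))"
      using cc by blast
    \<comment> \<open>For negative \<open>r\<close> the principal root of r^2 is -r, which flips all
      signs compared with the positive case.\<close>
    show "r = s \<and> Re r < 0 \<longrightarrow>
      ?x1 = 2 * csqrt (r * s) \<and> ?x2 = - csqrt (r * s) \<and> ?x3 = - csqrt (r * s)"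
    proof
      assume *: "r = s \<and> Re r < 0"
      then have "csqrt (r * s) = - r"
        using eq by (metis abs_of_neg of_real_minus)
      moreover have "?x1 = - 2 * r \<and> ?x2 = r \<and> ?x3 = r"
        using eq * by blast
      ultimately show "?x1 = 2 * csqrt (r * s) \<and> ?x2 = - csqrt (r * s) \<and> ?x3 = - csqrt (r * s)"
        by simp
    qed
    show "r = s \<and> Re r > 0 \<longrightarrow>
      ?x1 = - 2 * csqrt (r * s) \<and> ?x2 = csqrt (r * s) \<and> ?x3 = csqrt (r * s)"
    proof
      assume *: "r = s \<and> Re r > 0"
      then have "csqrt (r * s) = r"
        using eq by (metis abs_of_pos)
      then show "?x1 = - 2 * csqrt (r * s) \<and> ?x2 = csqrt (r * s) \<and> ?x3 = csqrt (r * s)"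
        using eq * by simp
    qed
  qed
qed

end
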